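(* Let $X\ne\{0\}$ be a real Banach space, $\emptyset\ne D\subset X$ open, $Y$ a real Hilbert space, $B\in C^1(D;Y^* )$ and $F\in Y^*$. Let $x\in D$ be a regular solution to $B(x)=F$ with inf-sup constant $$\beta(x):=\inf_{\xi\in X,\|\xi\|_X=1}\ \sup_{\eta\in Y,\|\eta\|_Y=1}\langle \mathrm{D}B(x)\xi,\eta\rangle>0 .$$ Then there exists some $\varepsilon>0$ such that $B(x,\varepsilon):=\{\tilde x\in X:\|x-\tilde x\|_X<\varepsilon\}\subset D$ and any $x_h\in B(x,\varepsilon)$ satisfies $$\frac{\beta(x)}{4}\|x-x_h\|_X\le\|F-B(x_h)\|_{Y^*}\le 2\,\|\mathrm{D}B(x)\|_{L(X;Y^* )}\,\|x-x_h\|_X .$$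
   Context: $\mathrm{D}B(x)\in L(X;Y^* )$ is the Fréchet derivative of $B$ at $x$. A regular solution is a point $x\in D$ with $B(x)=F$ such that $\mathrm{D}B(x)$ is a bijection from $X$ onto $Y^*$ (this implies $\beta(x)>0$). *)

theory Defs
  imports "HOL-Analysis.Analysis"
begin

(* Frechet derivative as an element of L(X;Z). Blinfun is only meaningful on bounded linear maps,
   so this is the derivative exactly where f is differentiable. *)
definition fderiv :: "('a::real_normed_vector \<Rightarrow> 'c::real_normed_vector) \<Rightarrow> 'a \<Rightarrow> ('a \<Rightarrow>\<^sub>L 'c)" where
  "fderiv f x = Blinfun (frechet_derivative f (at x))"

(* Intended for open D; then values of f outside D are irrelevant, and the total function f
   represents a map D -> Z. Continuity of the derivative is in the operator norm of L(X;Z). *)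
definition C1_on :: "'a::real_normed_vector set \<Rightarrow> ('a \<Rightarrow> 'c::real_normed_vector) \<Rightarrow> bool" where
  "C1_on D f \<longleftrightarrow> (\<forall>x\<in>D. f differentiable (at x)) \<and> continuous_on D (fderiv f)"

(* The dual Y* is the type of bounded linear functionals, with the operator norm. *)
type_synonym 'b dual = "'b \<Rightarrow>\<^sub>L real"

definition regular_solution ::
    "'a::real_normed_vector set \<Rightarrow> ('a \<Rightarrow> 'b::real_normed_vector dual) \<Rightarrow> 'b dual \<Rightarrow> 'a \<Rightarrow> bool" where
  "regular_solution D B F x \<longleftrightarrow> x \<in> D \<and> B x = F \<and> bij (blinfun_apply (fderiv B x))"

(* Inf and Sup are those of the reals. The Sup is over a bounded set, and both index sets are
   nonempty when X and Y are nontrivial; at a regular solution X \<noteq> {0} forces Y \<noteq> {0}. *)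
definition inf_sup_const ::
    "('a::real_normed_vector \<Rightarrow> 'b::real_normed_vector dual) \<Rightarrow> 'a \<Rightarrow> real" where
  "inf_sup_const B x =
     (INF \<xi>\<in>{\<xi>. norm \<xi> = 1}. SUP \<eta>\<in>{\<eta>. norm \<eta> = 1}.
        blinfun_apply (blinfun_apply (fderiv B x) \<xi>) \<eta>)"

end

(* The quantitative open mapping theorem (Baire category plus a geometric series) bounds the
   bijection DB(x) from below, so beta(x) > 0, and |DB(x) xi| >= beta(x) |xi|.
   Differentiability of B at x then gives |F - B(x_h) - DB(x)(x - x_h)| <= beta(x)/2 |x - x_h|
   near x, and beta(x) <= |DB(x)| turns this into both estimates. *)
theory Submission
  imports Defs
begin

text \<open>By Baire, the closure \<open>C n\<close> of the image of some ball contains a ball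
  around a point \<open>z\<close>. Subtracting approximate preimages of two points of that ball
  moves the centre to the origin, and scaling makes the bound linear in \<open>norm y\<close>. The
  constant \<open>K\<close> does not depend on the accuracy \<open>e\<close>, which permits
  iteration later.\<close>

lemma surj_blinfun_almost_preimage:
  fixes T :: "'a::real_normed_vector \<Rightarrow>\<^sub>L 'c::banach"
  assumes "surj (blinfun_apply T)"
  obtains K where "K \<ge> 0"
    "\<And>y e. e > 0 \<Longrightarrow> \<exists>x. norm x \<le> K * norm y \<and> norm (y - blinfun_apply T x) < e"
proof -
  define C where "C n = closure (blinfun_apply T ` cball 0 (real n))" for n :: nat
  have "y \<in> \<Union>(range C)" for y
  proof -
    obtain x where x: "y = blinfun_apply T x"
      using assms by blast
    obtain n :: nat where "norm x \<le> real n"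
      using real_arch_simple by blast
    then have "y \<in> C n"
      unfolding C_def x by (intro subsetD[OF closure_subset] imageI) simp
    then show ?thesis by blast
  qed
  then have UN: "\<Union>(range C) = UNIV" by blast
  have "\<exists>n. interior (C n) \<noteq> {}"
  proof (rule ccontr)
    assume "\<not> ?thesis"
    then have "(euclidean :: 'c topology) interior_of \<Union>(range C) = {}"
      by (intro Baire_category_alt) (auto simp: completely_metrizable_space_euclidean C_def)
    then show False
      unfolding UN by simp
  qed
  then obtain n z where "z \<in> interior (C n)" by blast
  then obtain r where r: "r > 0" "ball z r \<subseteq> C n"
    using mem_interior by blast
  have near: "\<exists>a. norm a \<le> real n \<and> norm (blinfun_apply T a - w) < d"
    if "norm (w - z) < r" "d > 0" for w d
  proof -
    have "w \<in> closure (blinfun_apply T ` cball 0 (real n))"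
      using r that by (auto simp: C_def dist_norm norm_minus_commute)
    then show ?thesis
      using \<open>d > 0\<close> unfolding closure_approachable dist_norm by force
  qed
  show thesis
  proof (rule that)
    show "0 \<le> 4 * real n / r" using r by simp
    fix y :: 'c and e :: real
    assume e: "e > 0"
    show "\<exists>x. norm x \<le> 4 * real n / r * norm y \<and> norm (y - blinfun_apply T x) < e"
    proof (cases "y = 0")
      case True
      then show ?thesis using e by (intro exI[of _ 0]) (simp add: blinfun.zero_right)
    next
      case False
      \<comment> \<open>This scaling gives \<open>inverse s *\<^sub>R y\<close> the norm r/2, so
        \<open>z\<close> and its translate both lie in \<open>ball z r\<close>. Each of the two
        approximations has error below e/(2s); together, scaled back by \<open>s\<close>, the errors
        stay below \<open>e\<close>.\<close>
      define s where "s = 2 * norm y / r"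
      have s: "s > 0" using False r by (simp add: s_def)
      have su: "s *\<^sub>R (inverse s *\<^sub>R y) = y" using s by simp
      have "norm (inverse s *\<^sub>R y) < r"
        using r False by (simp add: s_def field_simps)
      then obtain a b where a: "norm a \<le> real n" "norm (blinfun_apply T a - z) < e / (2 * s)"
        and b: "norm b \<le> real n"
          "norm (blinfun_apply T b - (z + inverse s *\<^sub>R y)) < e / (2 * s)"
        using near[of z "e / (2 * s)"] near[of "z + inverse s *\<^sub>R y" "e / (2 * s)"] r e s
        by auto
      let ?x = "s *\<^sub>R (b - a)"
      have "norm (b - a) \<le> 2 * real n"
        using norm_triangle_ineq4[of b a] a b by linarith
      then have "norm ?x \<le> s * (2 * real n)"
        using s by simp
      also have "\<dots> = 4 * real n / r * norm y"
        by (simp add: s_def)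
      finally have x: "norm ?x \<le> 4 * real n / r * norm y" .
      have "y - blinfun_apply T ?x = s *\<^sub>R ((blinfun_apply T a - z)
          - (blinfun_apply T b - (z + inverse s *\<^sub>R y)))"
        using s by (simp add: blinfun.scaleR_right blinfun.diff_right algebra_simps)
      then have "norm (y - blinfun_apply T ?x) = s * norm ((blinfun_apply T a - z)
          - (blinfun_apply T b - (z + inverse s *\<^sub>R y)))"
        using s by simp
      also have "\<dots> < s * (e / (2 * s) + e / (2 * s))"
        using s a b by (intro mult_strict_left_mono le_less_trans[OF norm_triangle_ineq4]) auto
      also have "\<dots> = e" using s by (simp add: field_simps)
      finally show ?thesis using x by blast
    qed
  qed
qed

text \<open>Repeated correction turns approximate preimages into an exact one: each correction at
  least halves the residual, so the corrections are dominated by a geometric series and their sum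
  converges in the complete domain. That series doubles the constant.\<close>

lemma surj_blinfun_bounded_preimage:
  fixes T :: "'a::banach \<Rightarrow>\<^sub>L 'c::banach"
  assumes "surj (blinfun_apply T)"
  obtains K where "K \<ge> 0" "\<And>y. \<exists>x. norm x \<le> K * norm y \<and> blinfun_apply T x = y"
proof -
  obtain K where K: "K \<ge> 0"
    and app: "\<And>y e. e > 0 \<Longrightarrow> \<exists>x. norm x \<le> K * norm y \<and> norm (y - blinfun_apply T x) < e"
    using surj_blinfun_almost_preimage[OF assms] by metis
  have "\<exists>x. norm x \<le> K * norm y \<and> norm (y - blinfun_apply T x) \<le> norm y / 2" for y
  proof (cases "y = 0")
    case True
    then show ?thesis by (intro exI[of _ 0]) (simp add: blinfun.zero_right)
  next
    case False
    then show ?thesis using app[of "norm y / 2" y] by force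
  qed
  then obtain g where g: "\<And>y. norm (g y) \<le> K * norm y"
    "\<And>y. norm (y - blinfun_apply T (g y)) \<le> norm y / 2"
    by metis
  show thesis
  proof (rule that)
    show "0 \<le> 2 * K" using K by simp
    fix y
    \<comment> \<open>\<open>r n\<close> is the residual after \<open>n\<close> corrections, and
      \<open>g (r n)\<close> is the next correction.\<close>
    define r where "r n = ((\<lambda>y. y - blinfun_apply T (g y)) ^^ n) y" for n
    have r0: "r 0 = y" and rS: "r (Suc n) = r n - blinfun_apply T (g (r n))" for n
      by (simp_all add: r_def)
    have rn: "norm (r n) \<le> norm y * (1/2) ^ n" for n
    proof (induction n)
      case (Suc n)
      then show ?case using g(2)[of "r n"] by (simp add: rS)
    qed (simp add: r0)
    have gn: "norm (g (r n)) \<le> K * norm y * (1/2) ^ n" for n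
      using g(1)[of "r n"] mult_left_mono[OF rn[of n] K] by (simp add: mult.assoc)
    have geo: "(\<lambda>n. K * norm y * (1/2) ^ n) sums (2 * K * norm y)"
      using sums_mult[OF geometric_sums[of "1/2::real"], of "K * norm y"] by (simp add: mult_ac)
    have sg: "summable (\<lambda>n. norm (g (r n)))"
      using gn by (intro summable_comparison_test'[OF sums_summable[OF geo], of 0]) simp
    \<comment> \<open>The sum telescopes, so vanishing residuals make the images of the corrections
      sum to \<open>y\<close>.\<close>
    have "(\<Sum>n<m. blinfun_apply T (g (r n))) = y - r m" for m
      by (induction m) (simp_all add: r0 rS)
    moreover have "r \<longlonglongrightarrow> 0"
    proof (rule Lim_null_comparison)
      show "(\<lambda>n. norm y * (1/2) ^ n) \<longlonglongrightarrow> 0"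
        by (intro tendsto_mult_right_zero LIMSEQ_power_zero) simp
    qed (use rn in simp)
    ultimately have "(\<lambda>n. blinfun_apply T (g (r n))) sums y"
      unfolding sums_def using tendsto_diff[OF tendsto_const[of y], of r 0] by simp
    moreover have "(\<lambda>n. blinfun_apply T (g (r n))) sums blinfun_apply T (\<Sum>n. g (r n))"
      by (rule bounded_linear.sums[OF blinfun.bounded_linear_right
            summable_sums[OF summable_norm_cancel[OF sg]]])
    ultimately have "blinfun_apply T (\<Sum>n. g (r n)) = y"
      using sums_unique2 by blast
    moreover have "norm (\<Sum>n. g (r n)) \<le> 2 * K * norm y"
      using summable_norm[OF sg] suminf_le[OF gn sg sums_summable[OF geo]] sums_unique[OF geo]
      by linarith
    ultimately show "\<exists>x. norm x \<le> 2 * K * norm y \<and> blinfun_apply T x = y" by blast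
  qed
qed

text \<open>By injectivity the preimage of \<open>blinfun_apply T \<xi>\<close> with controlled norm
  can only be \<xi> itself.\<close>

lemma bij_blinfun_bounded_below:
  fixes T :: "'a::banach \<Rightarrow>\<^sub>L 'c::banach"
  assumes "bij (blinfun_apply T)"
  obtains c where "c > 0" "\<And>\<xi>. c * norm \<xi> \<le> norm (blinfun_apply T \<xi>)"
proof -
  obtain K where K: "K \<ge> 0" "\<And>y. \<exists>x. norm x \<le> K * norm y \<and> blinfun_apply T x = y"
    using surj_blinfun_bounded_preimage[OF bij_is_surj[OF assms]] by metis
  show thesis
  proof (rule that)
    \<comment> \<open>Here \<open>K\<close> may be 0, so \<open>K + 1\<close> is inverted
      instead.\<close>
    show "1 / (K + 1) > 0" using K by simp
    fix \<xi>
    have "norm \<xi> \<le> K * norm (blinfun_apply T \<xi>)"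
      using K(2)[of "blinfun_apply T \<xi>"] bij_is_inj[OF assms] by (metis injD)
    also have "\<dots> \<le> (K + 1) * norm (blinfun_apply T \<xi>)"
      by (simp add: mult_right_mono)
    finally show "1 / (K + 1) * norm \<xi> \<le> norm (blinfun_apply T \<xi>)"
      using K by (simp add: field_simps)
  qed
qed

text \<open>The sphere is symmetric, so the supremum of signed values already bounds absolute
  values. A nonzero functional forces a nonzero vector, hence a nonempty sphere; over an empty one
  the real \<open>Sup\<close> would carry no information.\<close>

lemma SUP_unit_sphere_eq_norm_blinfun:
  fixes f :: "'b::real_normed_vector \<Rightarrow>\<^sub>L real"
  assumes "f \<noteq> 0"
  shows "(SUP \<eta>\<in>{\<eta>. norm \<eta> = 1}. blinfun_apply f \<eta>) = norm f" (is "?S = _")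
proof (rule antisym)
  have le: "blinfun_apply f \<eta> \<le> norm f" if "norm \<eta> = 1" for \<eta>
    using norm_blinfun[of f \<eta>] that by simp
  have bdd: "bdd_above (blinfun_apply f ` {\<eta>. norm \<eta> = 1})"
    using le by (intro bdd_aboveI2[of _ _ "norm f"]) auto
  have up: "\<bar>blinfun_apply f \<eta>\<bar> \<le> ?S * norm \<eta>" if "\<eta> \<noteq> 0" for \<eta>
  proof -
    \<comment> \<open>Both signs of \<open>s\<close> are used below, which yields the absolute
      value.\<close>
    have "blinfun_apply f (s *\<^sub>R \<eta>) \<le> ?S" if "\<bar>s\<bar> * norm \<eta> = 1" for s
      using that by (intro cSUP_upper bdd) simp
    from this[of "inverse (norm \<eta>)"] this[of "- inverse (norm \<eta>)"] that show ?thesis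
      by (simp add: blinfun.scaleR_right blinfun.minus_right field_simps abs_le_iff)
  qed
  obtain \<eta>0 where \<eta>0: "blinfun_apply f \<eta>0 \<noteq> 0"
    using assms by (metis blinfun_eqI blinfun.zero_left)
  then have nz: "\<eta>0 \<noteq> 0" by (auto simp: blinfun.zero_right)
  then have "norm ((1 / norm \<eta>0) *\<^sub>R \<eta>0) = 1" by simp
  then have "{\<eta>::'b. norm \<eta> = 1} \<noteq> {}" by blast
  then show "?S \<le> norm f"
    by (rule cSUP_least) (simp add: le)
  \<comment> \<open>\<open>norm_blinfun_bound\<close> requires a nonnegative constant; a point where
    \<open>f\<close> does not vanish supplies the sign.\<close>
  have "0 < ?S * norm \<eta>0" using up[OF nz] \<eta>0 by linarith
  then have "0 \<le> ?S" by (simp add: zero_less_mult_iff)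
  moreover have "norm (blinfun_apply f \<eta>) \<le> ?S * norm \<eta>" for \<eta>
    using up[of \<eta>] by (cases "\<eta> = 0") (simp_all add: blinfun.zero_right)
  ultimately show "norm f \<le> ?S"
    by (rule norm_blinfun_bound)
qed

text \<open>Bounded below, the derivative vanishes nowhere on the unit sphere, so each inner
  supremum is a dual norm and the constant becomes an infimum of \<open>norm (?T \<xi>)\<close>. The
  sphere is nonempty because the space is nontrivial, so the lower bound \<open>c\<close> passes to
  the infimum, and any single unit vector compares it with the operator norm.\<close>

lemma inf_sup_const_bij:
  fixes B :: "'a::banach \<Rightarrow> 'b::real_normed_vector dual"
  assumes "(UNIV :: 'a set) \<noteq> {0}" and bij: "bij (blinfun_apply (fderiv B x))"
  shows inf_sup_const_pos: "0 < inf_sup_const B x"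
    and inf_sup_const_le: "inf_sup_const B x * norm \<xi> \<le> norm (blinfun_apply (fderiv B x) \<xi>)"
    and inf_sup_const_le_norm: "inf_sup_const B x \<le> norm (fderiv B x)"
proof -
  let ?T = "blinfun_apply (fderiv B x)"
  obtain c where c: "c > 0" "\<And>\<xi>. c * norm \<xi> \<le> norm (?T \<xi>)"
    using bij_blinfun_bounded_below[OF bij] by metis
  have "?T \<xi> \<noteq> 0" if "norm \<xi> = 1" for \<xi>
    using c(1) c(2)[of \<xi>] that by auto
  then have eq: "inf_sup_const B x = (INF \<xi>\<in>{\<xi>. norm \<xi> = 1}. norm (?T \<xi>))"
    unfolding inf_sup_const_def by (intro INF_cong) (auto simp: SUP_unit_sphere_eq_norm_blinfun)
  obtain \<xi>0 :: 'a where "\<xi>0 \<noteq> 0"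
    using assms(1) by blast
  then have unit: "norm ((1 / norm \<xi>0) *\<^sub>R \<xi>0) = 1" by simp
  then have ne: "{\<xi>::'a. norm \<xi> = 1} \<noteq> {}" by blast
  have "c \<le> inf_sup_const B x"
    unfolding eq
  proof (rule cINF_greatest[OF ne])
    show "c \<le> norm (?T \<xi>)" if "\<xi> \<in> {\<xi>. norm \<xi> = 1}" for \<xi>
      using c(2)[of \<xi>] that by simp
  qed
  then show "0 < inf_sup_const B x" using c(1) by linarith
  have low: "inf_sup_const B x \<le> norm (?T \<xi>)" if "norm \<xi> = 1" for \<xi>
    unfolding eq using that by (intro cINF_lower bdd_belowI2[of _ 0]) auto
  show le: "inf_sup_const B x * norm \<xi> \<le> norm (?T \<xi>)" for \<xi>
  proof (cases "\<xi> = 0")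
    case False
    then show ?thesis
      using low[of "(1 / norm \<xi>) *\<^sub>R \<xi>"] by (simp add: blinfun.scaleR_right field_simps)
  qed simp
  show "inf_sup_const B x \<le> norm (fderiv B x)"
    using low[OF unit] norm_blinfun[of "fderiv B x" "(1 / norm \<xi>0) *\<^sub>R \<xi>0"] unfolding unit
    by simp
qed

lemma has_derivative_fderiv:
  assumes "f differentiable (at x)"
  shows "(f has_derivative blinfun_apply (fderiv f x)) (at x)"
  using assms unfolding fderiv_def frechet_derivative_works
  by (metis bounded_linear_Blinfun_apply has_derivative_bounded_linear)

theorem theorem2p12:
  fixes D :: "'a::banach set"
    and B :: "'a \<Rightarrow> 'b::{real_inner, complete_space} dual"
    and F :: "'b dual"
    and x :: 'a
  assumes "(UNIV :: 'a set) \<noteq> {0}"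
    and "D \<noteq> {}"
    and "open D"
    and "C1_on D B"
    and "regular_solution D B F x"
  shows "0 < inf_sup_const B x \<and>
    (\<exists>\<epsilon>>0. ball x \<epsilon> \<subseteq> D \<and>
      (\<forall>x\<^sub>h\<in>ball x \<epsilon>.
        inf_sup_const B x / 4 * norm (x - x\<^sub>h) \<le> norm (F - B x\<^sub>h) \<and>
        norm (F - B x\<^sub>h) \<le> 2 * norm (fderiv B x) * norm (x - x\<^sub>h)))"
proof -
  let ?\<beta> = "inf_sup_const B x" and ?T = "fderiv B x"
  from assms(5) have x: "x \<in> D" "B x = F" and bij: "bij (blinfun_apply ?T)"
    by (auto simp: regular_solution_def)
  note \<beta> = inf_sup_const_bij[OF assms(1) bij]
  have "(B has_derivative blinfun_apply ?T) (at x)"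
    using assms(4) x by (intro has_derivative_fderiv) (simp add: C1_on_def)
  \<comment> \<open>With tolerance \<beta>/2 for the linearization error, half of the lower bound
    \<beta> for the derivative survives.\<close>
  then obtain d where d: "d > 0" "\<And>y. norm (y - x) < d \<Longrightarrow>
      norm (B y - B x - blinfun_apply ?T (y - x)) \<le> ?\<beta> / 2 * norm (y - x)"
    using \<beta>(1) unfolding has_derivative_at_alt by (meson half_gt_zero)
  obtain e where e: "e > 0" "ball x e \<subseteq> D"
    using assms(3) x openE by blast
  have "?\<beta> / 4 * norm (x - y) \<le> norm (F - B y) \<and> norm (F - B y) \<le> 2 * norm ?T * norm (x - y)"
    if "y \<in> ball x (min d e)" for y
  proof -
    have "norm (B y - F - blinfun_apply ?T (y - x)) \<le> ?\<beta> / 2 * norm (y - x)"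
      using d(2)[of y] that x by (simp add: dist_norm norm_minus_commute)
    moreover have "?\<beta> * norm (y - x) \<le> norm (blinfun_apply ?T (y - x))"
      by (rule \<beta>(2))
    moreover have "norm (blinfun_apply ?T (y - x)) \<le> norm ?T * norm (y - x)"
      by (rule norm_blinfun)
    \<comment> \<open>The triangle inequality gives the factors \<beta>/2 below and
      \<open>norm ?T\<close> + \<beta>/2 above. These facts weaken the former to \<beta>/4 and bound
      the latter by 3/2, hence 2, times \<open>norm ?T\<close>.\<close>
    moreover have "?\<beta> * norm (y - x) \<le> norm ?T * norm (y - x)" "0 \<le> ?\<beta> * norm (y - x)"
      using \<beta>(1,3) by (simp_all add: mult_right_mono)
    ultimately show ?thesis
      using norm_triangle_sub[of "B y - F" "blinfun_apply ?T (y - x)"]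
        norm_triangle_sub[of "blinfun_apply ?T (y - x)" "B y - F"]
      unfolding norm_minus_commute[of x] norm_minus_commute[of F]
        norm_minus_commute[of "blinfun_apply ?T (y - x)"]
      by argo
  qed
  moreover have "min d e > 0" "ball x (min d e) \<subseteq> D"
    using d e by auto
  ultimately show ?thesis using \<beta>(1) by blast
qed

end
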